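(* Let $\mathcal A$ be the leaf set, $|\mathcal A|=K$, of a rooted tree of depth $L$, let $\sigma_1\ge\sigma_2\ge\dots\ge\sigma_L$ be scale parameters (with $\sigma_{L+1}=0$), and let $$\mathcal Y^T_\sigma=\Big\{(y_t)_{t=1}^T:\ \forall t,\ y_t:\mathcal A\to[0,1]\ \text{and}\ \forall a,b\in\mathcal A,\ |y_t(a)-y_t(b)|\le \sigma_{s(a,b)}\Big\}.$$ Let $\rho=\sigma_L$. If $K>2$, $T>32(K-1)\log(14)$ and $\rho>0.22\sqrt{(K-1)/T}$, then any randomized one-point bandit algorithm satisfies $$\sup_{(y_t)_{t=1}^T\in\mathcal Y^T_\sigma}\ \mathbb E\big[\mathrm{Reg}_T(y_{1:T})\big]\;>\;\frac1{504}\sqrt{T(K-1)} .$$ Equivalently, for any such algorithm there is a sequence $(y_t)_{t=1}^T\in\mathcal Y^T_\sigma$ on which its expected regret is $\Omega(\sqrt{KT})$.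
   Context: Tree: all leaves are at depth $L$; $V_j$ is the set of nodes at depth $j$ ($V_0$ contains only the root, $V_L=\mathcal A$). For leaves $a,b$ and $0\le j\le L$, write $a\sim_j b$ if $a$ and $b$ have the same ancestor at depth $j$ (each node is its own ancestor). The similarity of $a,b\in\mathcal A$ is $s(a,b)=1+\max\{j\in\{0,\dots,L\}: a\sim_j b\}$, so $s(a,a)=L+1$ and $s(a,b)\in\{1,\dots,L\}$ for $a\ne b$. One-point bandit game: for a fixed loss sequence $y_{1:T}$ unknown to the learner, at each round $t=1,\dots,T$ the learner picks (possibly at random, as a function of past observations and internal randomness) an action $A_t\in\mathcal A$, and observes only $y_t(A_t)$. The regret is $\mathrm{Reg}_T(y_{1:T})=\sum_{t=1}^T y_t(A_t)-\min_{a\in\mathcal A}\sum_{t=1}^T y_t(a)$, and the expectation is over the learner's randomness. $\log$ is the natural logarithm. *)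

theory Defs
  imports "HOL-Probability.Probability"
begin

text \<open>A rooted tree is given by its nodes, its root and its parent function. The value of
  the parent function at the root, or outside the node set, plays no role.\<close>

record 'v rtree =
  nodes :: "'v set"
  root :: 'v
  parent :: "'v \<Rightarrow> 'v"

definition rooted_tree :: "'v rtree \<Rightarrow> bool" where
  "rooted_tree G \<longleftrightarrow>
     finite (nodes G) \<and> root G \<in> nodes G \<and>
     (\<forall>v \<in> nodes G - {root G}. parent G v \<in> nodes G) \<and>
     (\<forall>v \<in> nodes G. \<exists>n. (parent G ^^ n) v = root G)"

definition children :: "'v rtree \<Rightarrow> 'v \<Rightarrow> 'v set" where
  "children G v = {w \<in> nodes G - {root G}. parent G w = v}"

definition leaves :: "'v rtree \<Rightarrow> 'v set" where
  "leaves G = {v \<in> nodes G. children G v = {}}"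

definition depth :: "'v rtree \<Rightarrow> 'v \<Rightarrow> nat" where
  "depth G v = (LEAST n. (parent G ^^ n) v = root G)"

definition level :: "'v rtree \<Rightarrow> nat \<Rightarrow> 'v set" where
  "level G j = {v \<in> nodes G. depth G v = j}"

definition ancestor :: "'v rtree \<Rightarrow> 'v \<Rightarrow> 'v \<Rightarrow> bool" where
  "ancestor G u v \<longleftrightarrow> (\<exists>n \<le> depth G v. (parent G ^^ n) v = u)"

text \<open>All leaves are at depth \<open>L\<close>; since the tree is finite, this makes the leaf set
  equal to \<open>level G L\<close>.\<close>

definition tree_of_depth :: "'v rtree \<Rightarrow> nat \<Rightarrow> bool" where
  "tree_of_depth G L \<longleftrightarrow> rooted_tree G \<and> (\<forall>a \<in> leaves G. depth G a = L)"

definition same_ancestor :: "'v rtree \<Rightarrow> nat \<Rightarrow> 'v \<Rightarrow> 'v \<Rightarrow> bool" where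
  "same_ancestor G j a b \<longleftrightarrow> (\<exists>u \<in> level G j. ancestor G u a \<and> ancestor G u b)"

definition similarity :: "'v rtree \<Rightarrow> nat \<Rightarrow> 'v \<Rightarrow> 'v \<Rightarrow> nat" where
  "similarity G L a b = 1 + Max {j \<in> {0..L}. same_ancestor G j a b}"

text \<open>Rounds are numbered from 1 to T. Losses at other rounds, or at non-leaves, are
  unconstrained and never used.\<close>

definition loss_sequences ::
  "'v rtree \<Rightarrow> nat \<Rightarrow> (nat \<Rightarrow> real) \<Rightarrow> nat \<Rightarrow> (nat \<Rightarrow> 'v \<Rightarrow> real) set" where
  "loss_sequences G L \<sigma> T =
     {y. \<forall>t \<in> {1..T}.
           (\<forall>a \<in> leaves G. y t a \<in> {0..1}) \<and>
           (\<forall>a \<in> leaves G. \<forall>b \<in> leaves G. \<bar>y t a - y t b\<bar> \<le> \<sigma> (similarity G L a b))}"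

text \<open>A randomized algorithm consists of a probability space \<open>M\<close> carrying all of its internal
  randomness (for all rounds at once) and a map \<open>\<pi>\<close> from the list of past observations and the
  random seed to the next action. The current round is one more than the length of the list, and
  past actions are functions of the seed and the past observations, so \<open>\<pi>\<close> need not receive
  either. For a fixed loss sequence only finitely many observation lists can occur, so
  measurability in the seed for each list suffices to make every played action a random
  variable.\<close>

definition bandit_algorithm ::
  "'v set \<Rightarrow> 'w measure \<Rightarrow> (real list \<Rightarrow> 'w \<Rightarrow> 'v) \<Rightarrow> bool" where
  "bandit_algorithm A M \<pi> \<longleftrightarrow>
     prob_space M \<and> (\<forall>h. \<pi> h \<in> measurable M (count_space A))"

text \<open>\<open>observations \<pi> y \<omega> t\<close> lists the losses observed in rounds 1 to t.\<close>

primrec observations ::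
  "(real list \<Rightarrow> 'w \<Rightarrow> 'v) \<Rightarrow> (nat \<Rightarrow> 'v \<Rightarrow> real) \<Rightarrow> 'w \<Rightarrow> nat \<Rightarrow> real list" where
  "observations \<pi> y \<omega> 0 = []"
| "observations \<pi> y \<omega> (Suc t) =
     observations \<pi> y \<omega> t @ [y (Suc t) (\<pi> (observations \<pi> y \<omega> t) \<omega>)]"

definition played ::
  "(real list \<Rightarrow> 'w \<Rightarrow> 'v) \<Rightarrow> (nat \<Rightarrow> 'v \<Rightarrow> real) \<Rightarrow> nat \<Rightarrow> 'w \<Rightarrow> 'v" where
  "played \<pi> y t \<omega> = \<pi> (observations \<pi> y \<omega> (t - 1)) \<omega>"

definition regret ::
  "'v set \<Rightarrow> nat \<Rightarrow> (real list \<Rightarrow> 'w \<Rightarrow> 'v) \<Rightarrow> (nat \<Rightarrow> 'v \<Rightarrow> real) \<Rightarrow> 'w \<Rightarrow> real" where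
  "regret A T \<pi> y \<omega> =
     (\<Sum>t = 1..T. y t (played \<pi> y t \<omega>)) - (MIN a \<in> A. \<Sum>t = 1..T. y t a)"

definition expected_regret ::
  "'v set \<Rightarrow> nat \<Rightarrow> 'w measure \<Rightarrow> (real list \<Rightarrow> 'w \<Rightarrow> 'v) \<Rightarrow> (nat \<Rightarrow> 'v \<Rightarrow> real) \<Rightarrow> real" where
  "expected_regret A T M \<pi> y = (\<integral>\<omega>. regret A T \<pi> y \<omega> \<partial>M)"

end

theory Submission
  imports Defs
begin

text \<open>All arms share the same noise, uniform on a grid of mesh \<open>1 / (2 m)\<close>, and one good arm lies
  either on the same grid point or one step below; so in every round the losses of two arms differ
  by at most \<open>1 / (2 m) \<le> \<sigma> L\<close>, the smallest scale. The learner sees only one loss, and the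
  relative entropy between the environment with a good arm and the one without grows
  by about \<open>1 / (2 m\<^sup>2)\<close> per pull of the good arm. As the arms share the \<open>T\<close> pulls of the
  environment without a good arm, for \<open>m\<close> of order \<open>sqrt (T / (K - 1))\<close> the learner pulls the good
  arm too rarely on average over its identity. Each other pull costs \<open>1 / (4 m)\<close> on average, and a
  loss sequence doing at least as badly as the average exists.\<close>

section \<open>Leaf similarity\<close>

lemma similarity_self:
  assumes "tree_of_depth G L" "a \<in> leaves G"
  shows "similarity G L a a = L + 1"
proof -
  have "depth G a = L" "a \<in> nodes G"
    using assms by (auto simp: tree_of_depth_def leaves_def)
  moreover have "ancestor G a a"
    unfolding ancestor_def by (rule exI[of _ 0]) simp
  ultimately have "same_ancestor G L a a"
    by (auto simp: same_ancestor_def level_def)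
  then have "Max {j \<in> {0..L}. same_ancestor G j a a} = L"
    by (intro Max_eqI) auto
  then show ?thesis by (simp add: similarity_def)
qed

text \<open>From a node reached by \<open>n\<close> parent steps the root is at most
  \<open>depth G v - n\<close> steps away, so equal depths force \<open>n = 0\<close>.\<close>

lemma ancestor_same_depth:
  assumes tree: "rooted_tree G" and v: "v \<in> nodes G"
    and anc: "ancestor G u v" and depth: "depth G u = depth G v"
  shows "u = v"
proof -
  obtain n where n: "n \<le> depth G v" "(parent G ^^ n) v = u"
    using anc by (auto simp: ancestor_def)
  have "\<exists>k. (parent G ^^ k) v = root G"
    using tree v by (auto simp: rooted_tree_def)
  then have "(parent G ^^ depth G v) v = root G"
    unfolding depth_def by (rule LeastI_ex)
  moreover have "(parent G ^^ depth G v) v = (parent G ^^ (depth G v - n)) ((parent G ^^ n) v)"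
    using n(1) by (metis comp_apply funpow_add le_add_diff_inverse2)
  ultimately have "(parent G ^^ (depth G v - n)) u = root G"
    using n(2) by simp
  then have "depth G u \<le> depth G v - n"
    unfolding depth_def[of G u] by (rule Least_le)
  then have "n = 0" using depth n(1) by simp
  then show ?thesis using n(2) by simp
qed

text \<open>The root is a common ancestor at depth \<open>0\<close>, and at depth \<open>L\<close> a
  leaf has no ancestor but itself. On the resulting range the scales are monotone, so
  \<open>\<sigma> L\<close> is the strictest bound.\<close>

lemma similarity_distinct:
  assumes tree: "tree_of_depth G L" and a: "a \<in> leaves G" and b: "b \<in> leaves G"
    and "a \<noteq> b"
  shows "1 \<le> similarity G L a b" "similarity G L a b \<le> L"
proof -
  show "1 \<le> similarity G L a b" by (simp add: similarity_def)
  have rt: "rooted_tree G" and da: "depth G a = L" and db: "depth G b = L"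
    and na: "a \<in> nodes G" and nb: "b \<in> nodes G"
    using tree a b by (auto simp: tree_of_depth_def leaves_def)
  have anc: "ancestor G (root G) v" if "v \<in> nodes G" for v
  proof -
    have "\<exists>k. (parent G ^^ k) v = root G"
      using rt that by (auto simp: rooted_tree_def)
    then have "(parent G ^^ depth G v) v = root G"
      unfolding depth_def by (rule LeastI_ex)
    then show ?thesis unfolding ancestor_def by blast
  qed
  have "depth G (root G) = 0"
    unfolding depth_def by (rule Least_equality) auto
  then have "root G \<in> level G 0"
    using rt by (simp add: level_def rooted_tree_def)
  then have "same_ancestor G 0 a b"
    unfolding same_ancestor_def using anc[OF na] anc[OF nb] by blast
  then have "Max {j \<in> {0..L}. same_ancestor G j a b} \<in> {j \<in> {0..L}. same_ancestor G j a b}"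
    by (intro Max_in) auto
  moreover have "\<not> same_ancestor G L a b"
  proof
    assume "same_ancestor G L a b"
    then obtain u where "depth G u = L" "ancestor G u a" "ancestor G u b"
      by (auto simp: same_ancestor_def level_def)
    then have "u = a" "u = b"
      using ancestor_same_depth[OF rt] na nb da db by auto
    with \<open>a \<noteq> b\<close> show False by simp
  qed
  ultimately have "Max {j \<in> {0..L}. same_ancestor G j a b} < L"
    by (metis (mono_tags, lifting) atLeastAtMost_iff le_neq_implies_less mem_Collect_eq)
  then show "similarity G L a b \<le> L" by (simp add: similarity_def)
qed

section \<open>Means over finite noise sequences\<close>

definition mean :: "'a set \<Rightarrow> ('a \<Rightarrow> real) \<Rightarrow> real" where
  "mean S f = (\<Sum>a\<in>S. f a) / real (card S)"

text \<open>For finite nonempty \<open>S\<close>, the expectation over \<open>t\<close> independent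
  uniform draws. The last draw is averaged first, given the earlier ones, which suits induction over
  rounds.\<close>

primrec seq_mean :: "'a set \<Rightarrow> nat \<Rightarrow> ('a list \<Rightarrow> real) \<Rightarrow> real" where
  "seq_mean S 0 G = G []"
| "seq_mean S (Suc t) G = seq_mean S t (\<lambda>zs. mean S (\<lambda>a. G (zs @ [a])))"

lemma mean_add: "mean S (\<lambda>a. f a + g a) = mean S f + mean S g"
  by (simp add: mean_def sum.distrib add_divide_distrib)

lemma mean_cmult: "mean S (\<lambda>a. c * f a) = c * mean S f"
  by (simp add: mean_def sum_distrib_left)

lemma mean_const: "finite S \<Longrightarrow> S \<noteq> {} \<Longrightarrow> mean S (\<lambda>a. c) = c"
  by (simp add: mean_def)

lemma mean_mono: "(\<And>a. a \<in> S \<Longrightarrow> f a \<le> g a) \<Longrightarrow> mean S f \<le> mean S g"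
  unfolding mean_def by (intro divide_right_mono sum_mono) auto

lemma seq_mean_add: "seq_mean S t (\<lambda>zs. f zs + g zs) = seq_mean S t f + seq_mean S t g"
  by (induction t arbitrary: f g) (simp_all add: mean_add)

lemma seq_mean_cmult: "seq_mean S t (\<lambda>zs. c * f zs) = c * seq_mean S t f"
  by (induction t arbitrary: f) (simp_all add: mean_cmult)

lemma seq_mean_const: "finite S \<Longrightarrow> S \<noteq> {} \<Longrightarrow> seq_mean S t (\<lambda>zs. c) = c"
  by (induction t) (simp_all add: mean_const)

lemma seq_mean_mono:
  "(\<And>zs. length zs = t \<Longrightarrow> set zs \<subseteq> S \<Longrightarrow> f zs \<le> g zs) \<Longrightarrow> seq_mean S t f \<le> seq_mean S t g"
proof (induction t arbitrary: f g)
  case (Suc t)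
  show ?case
    unfolding seq_mean.simps by (rule Suc.IH, rule mean_mono, rule Suc.prems) auto
qed simp

lemma seq_mean_cong:
  "(\<And>zs. length zs = t \<Longrightarrow> set zs \<subseteq> S \<Longrightarrow> f zs = g zs) \<Longrightarrow> seq_mean S t f = seq_mean S t g"
  by (intro antisym seq_mean_mono) auto

lemma seq_mean_sum:
  "seq_mean S t (\<lambda>zs. \<Sum>i\<in>I. f i zs) = (\<Sum>i\<in>I. seq_mean S t (f i))" if "finite S" "S \<noteq> {}"
  by (induction I rule: infinite_finite_induct)
    (simp_all add: seq_mean_add seq_mean_const[OF that])

text \<open>The probabilistic method: a bound for random noise yields one fixed noise
  sequence.\<close>

lemma seq_mean_exists:
  assumes "finite S" "S \<noteq> {}" "seq_mean S t f > B"
  shows "\<exists>zs. length zs = t \<and> set zs \<subseteq> S \<and> f zs > B"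
proof (rule ccontr)
  assume "\<not> ?thesis"
  then have "seq_mean S t f \<le> seq_mean S t (\<lambda>zs. B)"
    by (intro seq_mean_mono) force
  then show False using assms by (simp add: seq_mean_const)
qed

lemma mean_integrable:
  "(\<And>a. a \<in> S \<Longrightarrow> integrable M (f a)) \<Longrightarrow> integrable M (\<lambda>\<omega>. mean S (\<lambda>a. f a \<omega>))"
  unfolding mean_def by simp

lemma mean_integral:
  "(\<And>a. a \<in> S \<Longrightarrow> integrable M (f a)) \<Longrightarrow>
    mean S (\<lambda>a. \<integral>\<omega>. f a \<omega> \<partial>M) = (\<integral>\<omega>. mean S (\<lambda>a. f a \<omega>) \<partial>M)"
  unfolding mean_def by (simp add: Bochner_Integration.integral_sum)

lemma seq_mean_integrable:
  assumes "\<And>zs. length zs = t \<Longrightarrow> set zs \<subseteq> S \<Longrightarrow> integrable M (f zs)"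
  shows "integrable M (\<lambda>\<omega>. seq_mean S t (\<lambda>zs. f zs \<omega>))"
  using assms
proof (induction t arbitrary: f)
  case (Suc t)
  show ?case
    unfolding seq_mean.simps by (rule Suc.IH, rule mean_integrable, rule Suc.prems) auto
qed simp

text \<open>A finite Fubini exchange: lower bounds can be proved seed by seed, for a deterministic
  learner, and integrated afterwards.\<close>

lemma seq_mean_integral:
  assumes "\<And>zs. length zs = t \<Longrightarrow> set zs \<subseteq> S \<Longrightarrow> integrable M (f zs)"
  shows "seq_mean S t (\<lambda>zs. \<integral>\<omega>. f zs \<omega> \<partial>M) = (\<integral>\<omega>. seq_mean S t (\<lambda>zs. f zs \<omega>) \<partial>M)"
  using assms
proof (induction t arbitrary: f)
  case (Suc t)
  have "seq_mean S (Suc t) (\<lambda>zs. \<integral>\<omega>. f zs \<omega> \<partial>M)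
      = seq_mean S t (\<lambda>zs. \<integral>\<omega>. mean S (\<lambda>a. f (zs @ [a]) \<omega>) \<partial>M)"
    unfolding seq_mean.simps by (rule seq_mean_cong, rule mean_integral, rule Suc.prems) auto
  also have "\<dots> = (\<integral>\<omega>. seq_mean S (Suc t) (\<lambda>zs. f zs \<omega>) \<partial>M)"
    unfolding seq_mean.simps by (rule Suc.IH, rule mean_integrable, rule Suc.prems) auto
  finally show ?case .
qed simp

section \<open>The correlated loss environments\<close>

text \<open>In every round the noise \<open>(k, u)\<close> is shared by all arms. The number of \<open>u\<close> moving the
  loss of the good arm one grid step down from \<open>k\<close> is a tent function of \<open>k\<close>; as its increments
  are \<open>1\<close> on the lower half of the grid and \<open>-1\<close> on the upper half, the
  loss of the good arm has density \<open>1 \<plusminus> 1 / m\<close> with respect to the loss of the other arms.\<close>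

definition noise :: "nat \<Rightarrow> (nat \<times> nat) set" where
  "noise m = {..<2 * m} \<times> {..<m}"

definition base_loss :: "nat \<Rightarrow> nat \<times> nat \<Rightarrow> 'v \<Rightarrow> real" where
  "base_loss m z a = real (fst z) / (2 * real m)"

definition arm_loss :: "nat \<Rightarrow> 'v \<Rightarrow> nat \<times> nat \<Rightarrow> 'v \<Rightarrow> real" where
  "arm_loss m i z a =
     (real (fst z) - of_bool (a = i \<and> snd z < min (fst z) (2 * m - fst z))) / (2 * real m)"

lemma finite_noise: "finite (noise m)"
  by (simp add: noise_def)

lemma noise_nonempty: "m > 0 \<Longrightarrow> noise m \<noteq> {}"
  by (auto simp: noise_def lessThan_empty_iff)

lemma mean_noise:
  "mean (noise m) f = (\<Sum>k<2*m. \<Sum>u<m. f (k, u)) / (2 * real m * real m)"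
  by (simp add: mean_def noise_def sum.cartesian_product)

lemma arm_loss_range:
  assumes "z \<in> noise m"
  shows "arm_loss m i z a \<in> {0..1}"
proof -
  have "0 < m" "fst z < 2 * m" using assms by (auto simp: noise_def)
  \<comment> \<open>The tent is zero at \<open>0\<close>, so the lowest grid point never moves below
    zero.\<close>
  moreover have "fst z \<ge> 1" if "snd z < min (fst z) (2 * m - fst z)"
    using that by auto
  ultimately show ?thesis
    by (auto simp: arm_loss_def field_simps of_bool_def)
qed

lemma arm_loss_diff: "\<bar>arm_loss m i z a - arm_loss m i z b\<bar> \<le> 1 / (2 * real m)"
  by (auto simp: arm_loss_def of_bool_def diff_divide_distrib)

lemma sum_if_less:
  fixes x y :: real
  assumes "c \<le> m"
  shows "(\<Sum>u<m. if u < c then x else y) = real c * x + (real m - real c) * y"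
proof -
  have "(\<Sum>u<m. if u < c then x else y) = (\<Sum>u\<in>{..<m} \<inter> {u. u < c}. x) + (\<Sum>u\<in>{..<m} \<inter> - {u. u < c}. y)"
    by (rule sum.If_cases) simp
  also have "{..<m} \<inter> {u. u < c} = {..<c}" using assms by auto
  also have "{..<m} \<inter> - {u. u < c} = {c..<m}" by auto
  finally show ?thesis using assms by (simp add: of_nat_diff)
qed

text \<open>The rising half contributes \<open>k\<close> and the falling half \<open>m - k\<close>;
  paired up, they give \<open>m\<close> terms equal to \<open>m\<close>.\<close>

lemma sum_tent: "(\<Sum>k<2*m. real (min k (2 * m - k))) = real m * real m"
proof -
  have "(\<Sum>k<2*m. min k (2 * m - k)) = (\<Sum>k<m. min k (2 * m - k)) + (\<Sum>k=m..<m+m. min k (2 * m - k))"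
    using sum.atLeastLessThan_concat[of 0 m "m + m" "\<lambda>k. min k (2 * m - k)"]
    by (simp add: lessThan_atLeast0 mult_2)
  also have "(\<Sum>k<m. min k (2 * m - k)) = (\<Sum>k<m. k)"
    by (rule sum.cong) auto
  also have "(\<Sum>k=m..<m+m. min k (2 * m - k)) = (\<Sum>k<m. m - k)"
    using sum.shift_bounds_nat_ivl[of "\<lambda>k. min k (2 * m - k)" 0 m m]
    by (simp add: lessThan_atLeast0)
  also have "(\<Sum>k<m. k) + (\<Sum>k<m. m - k) = (\<Sum>k<m. m)"
    by (subst sum.distrib[symmetric]) (rule sum.cong, auto)
  finally have "(\<Sum>k<2*m. min k (2 * m - k)) = m * m" by simp
  then show ?thesis by (metis of_nat_mult of_nat_sum)
qed

text \<open>By \<open>sum_tent\<close> the shift occurs for half of the noise values, and its size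
  is \<open>1 / (2 * m)\<close>.\<close>

lemma mean_gap:
  assumes "m > 0"
  shows "mean (noise m) (\<lambda>z. arm_loss m i z a - arm_loss m i z i) = of_bool (a \<noteq> i) / (4 * real m)"
proof (cases "a = i")
  case True
  then show ?thesis by (simp add: mean_def)
next
  case False
  then have "arm_loss m i (k, u) a - arm_loss m i (k, u) i
      = (if u < min k (2 * m - k) then 1 / (2 * real m) else 0)" for k u
    by (auto simp: arm_loss_def diff_divide_distrib)
  then have "(\<Sum>u<m. arm_loss m i (k, u) a - arm_loss m i (k, u) i)
      = real (min k (2 * m - k)) / (2 * real m)" for k
    using sum_if_less[of "min k (2 * m - k)" m "1 / (2 * real m)" 0] by simp
  then have "mean (noise m) (\<lambda>z. arm_loss m i z a - arm_loss m i z i)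
      = (\<Sum>k<2*m. real (min k (2 * m - k)) / (2 * real m)) / (2 * real m * real m)"
    by (simp only: mean_noise)
  also have "\<dots> = (real m * real m) / (2 * real m) / (2 * real m * real m)"
    by (simp only: sum_divide_distrib[symmetric] sum_tent)
  finally show ?thesis using False assms by (simp add: field_simps)
qed

text \<open>Grid point \<open>k\<close> is observed if \<open>k\<close> stays or
  \<open>k + 1\<close> is lowered, hence with weight \<open>m - c k + c (Suc k)\<close>; the
  increment of the tent \<open>c\<close> is the sign on the right.\<close>

lemma mean_tilt:
  assumes "m > 0"
  shows "mean (noise m) (\<lambda>z. f (arm_loss m i z i))
    = mean (noise m) (\<lambda>z. (1 + (if base_loss m z i < 1 / 2 then 1 else - 1) / real m) * f (base_loss m z i))"
proof -
  define c where "c k = min k (2 * m - k)" for k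
  define g where "g x = f (x / (2 * real m))" for x :: real
  have cm: "c k \<le> m" for k by (auto simp: c_def)
  have arm: "f (arm_loss m i (k, u) i) = (if u < c k then g (real k - 1) else g (real k))" for k u
    by (simp add: arm_loss_def g_def c_def)
  \<comment> \<open>The tent vanishes at \<open>0\<close> and at \<open>2 * m\<close>, so
    re-indexing leaves no boundary term.\<close>
  have shift: "(\<Sum>k<2*m. real (c k) * g (real k - 1)) = (\<Sum>k<2*m. real (c (Suc k)) * g (real k))"
  proof -
    have "(\<Sum>k<2*m. real (c k) * g (real k - 1)) = (\<Sum>k<Suc (2*m). real (c k) * g (real k - 1))"
      by (simp add: c_def)
    also have "\<dots> = (\<Sum>k<2*m. real (c (Suc k)) * g (real k))"
      by (subst sum.lessThan_Suc_shift) (simp add: c_def)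
    finally show ?thesis .
  qed
  have "(\<Sum>k<2*m. \<Sum>u<m. f (arm_loss m i (k, u) i))
      = (\<Sum>k<2*m. real (c k) * g (real k - 1)) + (\<Sum>k<2*m. (real m - real (c k)) * g (real k))"
    by (simp only: arm sum_if_less[OF cm] sum.distrib)
  also have "\<dots> = (\<Sum>k<2*m. (real (c (Suc k)) + real m - real (c k)) * g (real k))"
    by (simp only: shift sum.distrib[symmetric]) (simp add: algebra_simps)
  also have "\<dots> = (\<Sum>k<2*m. (real m + (if k < m then 1 else - 1)) * g (real k))"
    by (intro sum.cong refl arg_cong2[where f = "(*)"]) (auto simp: c_def min_def of_nat_diff)
  also have "\<dots> = (\<Sum>k<2*m. \<Sum>u<m. (1 + (if base_loss m (k, u) i < 1 / 2 then 1 else - 1) / real m)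
      * f (base_loss m (k, u) i))"
    using assms by (intro sum.cong refl) (auto simp: base_loss_def g_def field_simps)
  finally show ?thesis by (simp add: mean_noise)
qed

lemma mean_sign:
  assumes "m > 0"
  shows "mean (noise m) (\<lambda>z. if base_loss m z i < 1 / 2 then x else y) = (x + y) / 2"
proof -
  have "mean (noise m) (\<lambda>z. if base_loss m z i < 1 / 2 then x else y)
      = (\<Sum>k<2*m. real m * (if k < m then x else y)) / (2 * real m * real m)"
    using assms unfolding mean_noise
    by (intro arg_cong2[where f = "(/)"] sum.cong refl) (auto simp: base_loss_def field_simps)
  also have "\<dots> = (x + y) / 2"
    using assms by (simp only: sum_distrib_left[symmetric] sum_if_less[of m "2 * m"]) (simp add: field_simps)
  finally show ?thesis .
qed

section \<open>Change of measure\<close>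

text \<open>Here \<open>p\<close> is a learner whose seed is already fixed, and the losses are
  driven by a noise list instead of the round number.\<close>

definition history :: "(real list \<Rightarrow> 'v) \<Rightarrow> ('z \<Rightarrow> 'v \<Rightarrow> real) \<Rightarrow> 'z list \<Rightarrow> real list" where
  "history p l zs = foldl (\<lambda>h z. h @ [l z (p h)]) [] zs"

text \<open>The actions of a deterministic learner can be recovered from the observed prefixes, so
  the count is a function of the history alone, as \<open>change_of_measure\<close>
  requires.\<close>

definition pulls :: "(real list \<Rightarrow> 'v) \<Rightarrow> 'v \<Rightarrow> real list \<Rightarrow> real" where
  "pulls p i h = (\<Sum>s<length h. of_bool (p (take s h) = i))"

text \<open>The likelihood ratio of one observation \<open>x\<close>; the flag \<open>b\<close>
  tells whether the good arm was pulled.\<close>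

definition tilt :: "nat \<Rightarrow> bool \<Rightarrow> real \<Rightarrow> real" where
  "tilt m b x = 1 + of_bool b * (if x < 1 / 2 then 1 else - 1) / real m"

text \<open>The density of the history law under good arm \<open>i\<close> with respect to the law
  without a good arm.\<close>

definition likelihood :: "nat \<Rightarrow> (real list \<Rightarrow> 'v) \<Rightarrow> 'v \<Rightarrow> real list \<Rightarrow> real" where
  "likelihood m p i h = (\<Prod>s<length h. tilt m (p (take s h) = i) (h ! s))"

text \<open>With the fixed comparator \<open>i\<close> in place of the best arm in hindsight, the
  regret is additive over rounds.\<close>

definition pseudo_regret :: "(real list \<Rightarrow> 'v) \<Rightarrow> ('z \<Rightarrow> 'v \<Rightarrow> real) \<Rightarrow> 'v \<Rightarrow> 'z list \<Rightarrow> real" where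
  "pseudo_regret p l i zs =
     (\<Sum>s<length zs. l (zs ! s) (p (history p l (take s zs))) - l (zs ! s) i)"

lemma history_Nil [simp]: "history p l [] = []"
  by (simp add: history_def)

lemma history_snoc [simp]: "history p l (zs @ [z]) = history p l zs @ [l z (p (history p l zs))]"
  by (simp add: history_def)

lemma length_history [simp]: "length (history p l zs) = length zs"
  by (induction zs rule: rev_induct) auto

lemma pulls_Nil [simp]: "pulls p i [] = 0"
  by (simp add: pulls_def)

lemma pulls_snoc [simp]: "pulls p i (h @ [x]) = pulls p i h + of_bool (p h = i)"
  by (simp add: pulls_def)

lemma pulls_nonneg: "0 \<le> pulls p i h"
  unfolding pulls_def by (rule sum_nonneg) simp

lemma pulls_le_length: "pulls p i h \<le> real (length h)"
  unfolding pulls_def by (rule order_trans[OF sum_bounded_above[where K = 1]]) auto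

lemma sum_pulls:
  assumes "finite A" "\<And>h. p h \<in> A"
  shows "(\<Sum>i\<in>A. pulls p i h) = real (length h)"
  by (induction h rule: rev_induct) (use assms in \<open>auto simp: sum.distrib of_bool_def sum.delta\<close>)

lemma likelihood_Nil [simp]: "likelihood m p i [] = 1"
  by (simp add: likelihood_def)

lemma likelihood_snoc [simp]:
  "likelihood m p i (h @ [x]) = likelihood m p i h * tilt m (p h = i) x"
  by (simp add: likelihood_def nth_append)

lemma tilt_pos: "m > 1 \<Longrightarrow> tilt m b x > 0"
  by (simp add: tilt_def field_simps)

lemma likelihood_pos: "m > 1 \<Longrightarrow> likelihood m p i h > 0"
  by (simp add: likelihood_def prod_pos tilt_pos)

lemma pseudo_regret_Nil [simp]: "pseudo_regret p l i [] = 0"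
  by (simp add: pseudo_regret_def)

lemma pseudo_regret_snoc [simp]:
  "pseudo_regret p l i (zs @ [z]) = pseudo_regret p l i zs + (l z (p (history p l zs)) - l z i)"
  by (simp add: pseudo_regret_def nth_append)

text \<open>In the last round, \<open>mean_tilt\<close> applies if the good arm is pulled, and
  otherwise both environments agree. The mean over that round is absorbed into \<open>F\<close>, so
  the induction is over all \<open>F\<close>.\<close>

lemma change_of_measure:
  fixes p :: "real list \<Rightarrow> 'v"
  assumes "m > 0"
  shows "seq_mean (noise m) t (\<lambda>zs. F (history p (arm_loss m i) zs))
    = seq_mean (noise m) t (\<lambda>zs. likelihood m p i (history p (base_loss m) zs) * F (history p (base_loss m) zs))"
proof (induction t arbitrary: F)
  case 0
  then show ?case by simp
next
  case (Suc t)
  have step: "mean (noise m) (\<lambda>z. F (h @ [arm_loss m i z (p h)]))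
      = mean (noise m) (\<lambda>z. tilt m (p h = i) (base_loss m z (p h)) * F (h @ [base_loss m z (p h)]))" for h
  proof (cases "p h = i")
    case True
    then show ?thesis
      using mean_tilt[OF assms, of "\<lambda>x. F (h @ [x])" i] by (simp add: tilt_def)
  next
    case False
    then show ?thesis by (simp add: tilt_def arm_loss_def base_loss_def)
  qed
  then show ?case
    by (simp only: seq_mean.simps history_snoc likelihood_snoc step mult.assoc mean_cmult
        Suc.IH[of "\<lambda>h. mean (noise m) (\<lambda>z. tilt m (p h = i) (base_loss m z (p h)) * F (h @ [base_loss m z (p h)]))"])
qed

lemma mean_likelihood:
  assumes "m > 0"
  shows "seq_mean (noise m) t (\<lambda>zs. likelihood m p i (history p (base_loss m) zs)) = 1"
  using change_of_measure[OF assms, of t "\<lambda>_. 1" p i]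
  by (simp add: seq_mean_const finite_noise noise_nonempty[OF assms])

text \<open>The chain rule for relative entropy, with reversed sign: each pull of arm
  \<open>i\<close> contributes the average of \<open>ln (1 + 1 / m)\<close> and
  \<open>ln (1 - 1 / m)\<close>, any other pull nothing.\<close>

lemma mean_ln_likelihood:
  assumes "m > 1"
  shows "seq_mean (noise m) t (\<lambda>zs. ln (likelihood m p i (history p (base_loss m) zs)))
    = ln (1 - 1 / (real m)\<^sup>2) / 2 * seq_mean (noise m) t (\<lambda>zs. pulls p i (history p (base_loss m) zs))"
proof (induction t)
  case 0
  then show ?case by simp
next
  case (Suc t)
  have m: "m > 0" "1 / real m < 1" using assms by auto
  have ln: "ln (1 + 1 / real m) + ln (1 - 1 / real m) = ln (1 - 1 / (real m)\<^sup>2)"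
    using m by (subst ln_mult_pos[symmetric]) (auto simp: add_pos_pos field_simps power2_eq_square)
  have step: "mean (noise m) (\<lambda>z. ln (tilt m b (base_loss m z a))) = ln (1 - 1 / (real m)\<^sup>2) / 2 * of_bool b"
    for b and a :: 'a
  proof (cases b)
    case True
    then have "mean (noise m) (\<lambda>z. ln (tilt m b (base_loss m z a)))
      = mean (noise m) (\<lambda>z. if base_loss m z a < 1 / 2 then ln (1 + 1 / real m) else ln (1 - 1 / real m))"
      by (intro arg_cong[where f = "mean (noise m)"] ext) (simp add: tilt_def)
    then show ?thesis using ln True by (simp only: mean_sign[OF m(1)]) simp
  qed (simp add: tilt_def mean_def)
  have "mean (noise m) (\<lambda>z. ln (likelihood m p i (h @ [base_loss m z (p h)])))
      = ln (likelihood m p i h) + ln (1 - 1 / (real m)\<^sup>2) / 2 * of_bool (p h = i)" for h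
    using likelihood_pos[OF assms, of p i h] tilt_pos[OF assms]
    by (simp add: ln_mult_pos mean_add step mean_const finite_noise noise_nonempty[OF m(1)])
  moreover have "mean (noise m) (\<lambda>z. pulls p i (h @ [base_loss m z (p h)])) = pulls p i h + of_bool (p h = i)" for h
    by (simp add: mean_const finite_noise noise_nonempty[OF m(1)])
  ultimately show ?case
    by (simp only: seq_mean.simps history_snoc seq_mean_add seq_mean_cmult Suc.IH) (simp add: algebra_simps)
qed

section \<open>From relative entropy to pull counts\<close>

text \<open>With a likelihood ratio for \<open>x\<close>, averaging turns the left side into total
  variation distance and \<open>x - 1 - ln x\<close> into relative entropy.\<close>

lemma one_minus_le_ln:
  fixes x :: real
  assumes "x > 0"
  shows "max 0 (1 - x) \<le> 1 / 3 + 2 * (x - 1 - ln x)"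
proof -
  \<comment> \<open>The tangent of \<open>ln\<close> is taken at \<open>2 / 3\<close>, where
    \<open>1 - x - 2 * (x - 1 - ln x)\<close> is largest.\<close>
  have "ln (x * (3 / 2)) \<le> x * (3 / 2) - 1" "ln (2 / 3 :: real) \<le> 2 / 3 - 1" "ln x \<le> x - 1"
    by (rule ln_le_minus_one; use assms in simp)+
  moreover have "ln (x * (3 / 2)) = ln x - ln (2 / 3)"
    using assms by (simp add: ln_mult_pos ln_div)
  ultimately show ?thesis by auto
qed

text \<open>The linear bound \<open>one_minus_le_ln\<close> replaces Pinsker's inequality, so that no square roots
  of pull counts have to be averaged over the arms.\<close>

lemma mean_pulls_le:
  assumes "m > 1"
  shows "seq_mean (noise m) t (\<lambda>zs. pulls p i (history p (arm_loss m i) zs))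
    \<le> real t / 3 + (1 + real t / ((real m)\<^sup>2 - 1)) * seq_mean (noise m) t (\<lambda>zs. pulls p i (history p (base_loss m) zs))"
proof -
  have m: "m > 0" using assms by simp
  let ?E = "seq_mean (noise m) t"
  define X where "X zs = likelihood m p i (history p (base_loss m) zs)" for zs
  define N where "N zs = pulls p i (history p (base_loss m) zs)" for zs
  \<comment> \<open>The right side is affine in \<open>N zs\<close>, \<open>X zs\<close> and
    \<open>ln (X zs)\<close>, and the means of the latter two are known.\<close>
  have "X zs * N zs \<le> N zs + (3 * real t * X zs + (- (8 / 3) * real t + (- 2 * real t) * ln (X zs)))"
    if "length zs = t" for zs
  proof -
    have "0 \<le> N zs" "N zs \<le> real t"
      using pulls_nonneg pulls_le_length[of p i "history p (base_loss m) zs"] that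
      by (auto simp: N_def)
    moreover have Xpos: "X zs > 0" using likelihood_pos[OF assms] by (simp add: X_def)
    ultimately have "(X zs - 1) * N zs \<le> max 0 (X zs - 1) * real t"
      by (intro mult_mono) auto
    \<comment> \<open>As \<open>X\<close> has mean \<open>1\<close>, the positive parts of
      \<open>X - 1\<close> and \<open>1 - X\<close> have the same mean.\<close>
    also have "max 0 (X zs - 1) = (X zs - 1) + max 0 (1 - X zs)" by auto
    also have "\<dots> * real t \<le> ((X zs - 1) + (1 / 3 + 2 * (X zs - 1 - ln (X zs)))) * real t"
      using one_minus_le_ln[OF Xpos] by (intro mult_right_mono) auto
    finally show ?thesis by (simp add: algebra_simps)
  qed
  then have "?E (\<lambda>zs. X zs * N zs)
      \<le> ?E (\<lambda>zs. N zs + (3 * real t * X zs + (- (8 / 3) * real t + (- 2 * real t) * ln (X zs))))"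
    by (intro seq_mean_mono)
  also have "\<dots> = ?E N + (3 * real t * ?E X + (- (8 / 3) * real t + (- 2 * real t) * ?E (\<lambda>zs. ln (X zs))))"
    by (simp only: seq_mean_add seq_mean_cmult seq_mean_const[OF finite_noise noise_nonempty[OF m]])
  also have "?E X = 1" unfolding X_def by (rule mean_likelihood[OF m])
  also have "?E (\<lambda>zs. ln (X zs)) = ln (1 - 1 / (real m)\<^sup>2) / 2 * ?E N"
    unfolding X_def N_def by (rule mean_ln_likelihood[OF assms])
  finally have *: "?E (\<lambda>zs. X zs * N zs) \<le> ?E N + real t / 3 + real t * (- ln (1 - 1 / (real m)\<^sup>2)) * ?E N"
    by (simp add: algebra_simps)
  have "?E N \<ge> ?E (\<lambda>zs. 0)"
    unfolding N_def by (intro seq_mean_mono pulls_nonneg)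
  then have EN: "?E N \<ge> 0" by (simp add: seq_mean_const finite_noise noise_nonempty[OF m])
  have m2: "(real m)\<^sup>2 > 1" using assms by (simp add: power2_eq_square less_1_mult)
  have m3: "1 / (real m)\<^sup>2 < 1" using m2 less_trans[OF zero_less_one m2] by (metis divide_less_eq_1_pos)
  \<comment> \<open>Inverting the argument gives an upper bound on \<open>- ln\<close> from
    \<open>ln_le_minus_one\<close>.\<close>
  have "- ln (1 - 1 / (real m)\<^sup>2) = ln (1 / (1 - 1 / (real m)\<^sup>2))"
    using m3 by (simp add: ln_div)
  also have "\<dots> \<le> 1 / (1 - 1 / (real m)\<^sup>2) - 1"
    using m3 by (intro ln_le_minus_one) simp
  also have "\<dots> = 1 / ((real m)\<^sup>2 - 1)"
    using m2 m by (simp add: field_simps)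
  finally have "real t * (- ln (1 - 1 / (real m)\<^sup>2)) * ?E N \<le> real t * (1 / ((real m)\<^sup>2 - 1)) * ?E N"
    using EN by (intro mult_right_mono mult_left_mono) auto
  moreover have "seq_mean (noise m) t (\<lambda>zs. pulls p i (history p (arm_loss m i) zs)) = ?E (\<lambda>zs. X zs * N zs)"
    unfolding X_def N_def by (rule change_of_measure[OF m])
  ultimately show ?thesis using * by (simp add: N_def[symmetric] algebra_simps)
qed

section \<open>Regret summed over the possible good arms\<close>

text \<open>The action is determined before the noise of its round, so by \<open>mean_gap\<close>
  each pull of another arm costs \<open>1 / (4 * m)\<close> on average.\<close>

lemma mean_pseudo_regret:
  assumes "m > 0"
  shows "seq_mean (noise m) t (pseudo_regret p (arm_loss m i) i)
    = (real t - seq_mean (noise m) t (\<lambda>zs. pulls p i (history p (arm_loss m i) zs))) / (4 * real m)"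
proof (induction t)
  case 0
  then show ?case by simp
next
  case (Suc t)
  let ?h = "\<lambda>zs. history p (arm_loss m i) zs"
  note c = mean_const[OF finite_noise noise_nonempty[OF assms]]
    seq_mean_const[OF finite_noise noise_nonempty[OF assms]]
  have "seq_mean (noise m) (Suc t) (pseudo_regret p (arm_loss m i) i)
      = seq_mean (noise m) t (\<lambda>zs. pseudo_regret p (arm_loss m i) i zs
          + (1 / (4 * real m) + (- 1 / (4 * real m)) * of_bool (p (?h zs) = i)))"
    by (simp add: mean_add mean_gap[OF assms] c) (rule seq_mean_cong, simp add: of_bool_def)
  also have "\<dots> = seq_mean (noise m) t (pseudo_regret p (arm_loss m i) i)
      + (1 / (4 * real m) + (- 1 / (4 * real m)) * seq_mean (noise m) t (\<lambda>zs. of_bool (p (?h zs) = i)))"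
    by (simp only: seq_mean_add seq_mean_cmult c)
  finally have "seq_mean (noise m) (Suc t) (pseudo_regret p (arm_loss m i) i)
      = seq_mean (noise m) t (pseudo_regret p (arm_loss m i) i)
      + (1 / (4 * real m) + (- 1 / (4 * real m)) * seq_mean (noise m) t (\<lambda>zs. of_bool (p (?h zs) = i)))" .
  moreover have "seq_mean (noise m) (Suc t) (\<lambda>zs. pulls p i (?h zs))
      = seq_mean (noise m) t (\<lambda>zs. pulls p i (?h zs)) + seq_mean (noise m) t (\<lambda>zs. of_bool (p (?h zs) = i))"
    by (simp add: seq_mean_add c)
  ultimately show ?case
    unfolding Suc.IH by (simp add: add_divide_distrib diff_divide_distrib del: seq_mean.simps)
qed

text \<open>The environment without a good arm is the same for every \<open>i\<close>, so the counts
  \<open>N i\<close> share \<open>t\<close> pulls; \<open>mean_pulls_le\<close> is linear in them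
  and can be summed.\<close>

lemma sum_mean_pseudo_regret:
  assumes A: "finite A" "\<And>h. p h \<in> A" and m: "m > 1"
  shows "(\<Sum>i\<in>A. seq_mean (noise m) t (pseudo_regret p (arm_loss m i) i))
    \<ge> real t * (2 / 3 * real (card A) - 1 - real t / ((real m)\<^sup>2 - 1)) / (4 * real m)"
proof -
  have m0: "m > 0" using m by simp
  define N where "N i = seq_mean (noise m) t (\<lambda>zs. pulls p i (history p (base_loss m) zs))" for i
  define c where "c = 1 + real t / ((real m)\<^sup>2 - 1)"
  have "(\<Sum>i\<in>A. N i) = seq_mean (noise m) t (\<lambda>zs. \<Sum>i\<in>A. pulls p i (history p (base_loss m) zs))"
    unfolding N_def by (rule seq_mean_sum[OF finite_noise noise_nonempty[OF m0], symmetric])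
  also have "\<dots> = seq_mean (noise m) t (\<lambda>zs. real t)"
    by (rule seq_mean_cong) (simp add: sum_pulls[OF A])
  finally have N: "(\<Sum>i\<in>A. N i) = real t"
    by (simp add: seq_mean_const finite_noise noise_nonempty[OF m0])
  have "real t * (2 / 3 * real (card A) - c) / (4 * real m)
      = (\<Sum>i\<in>A. (2 / 3 * real t - c * N i) / (4 * real m))"
    by (simp add: sum_divide_distrib[symmetric] sum_subtractf sum_distrib_left[symmetric] N algebra_simps)
  also have "\<dots> \<le> (\<Sum>i\<in>A. seq_mean (noise m) t (pseudo_regret p (arm_loss m i) i))"
  proof (rule sum_mono)
    fix i
    show "(2 / 3 * real t - c * N i) / (4 * real m) \<le> seq_mean (noise m) t (pseudo_regret p (arm_loss m i) i)"
      using mean_pulls_le[OF m, of t p i] unfolding mean_pseudo_regret[OF m0] N_def c_def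
      by (intro divide_right_mono) auto
  qed
  finally show ?thesis by (simp add: c_def diff_diff_eq)
qed

section \<open>Regret of a bandit algorithm\<close>

text \<open>Each \<open>\<pi> h\<close> is measurable for fixed \<open>h\<close>; inserting a random
  history preserves this because the history ranges over a countable set.\<close>

lemma observations_measurable:
  assumes alg: "bandit_algorithm A M \<pi>" and A: "finite A"
  shows "\<exists>I. countable I \<and> (\<lambda>\<omega>. observations \<pi> y \<omega> t) \<in> measurable M (count_space I)"
proof (induction t)
  case 0
  show ?case by (rule exI[of _ "{[]}"]) simp
next
  case (Suc t)
  then obtain I where I: "countable I" "(\<lambda>\<omega>. observations \<pi> y \<omega> t) \<in> measurable M (count_space I)"
    by blast
  let ?J = "(\<lambda>(h, a). h @ [y (Suc t) a]) ` (I \<times> A)"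
  have "(\<lambda>\<omega>. (\<lambda>h \<omega>. h @ [y (Suc t) (\<pi> h \<omega>)]) (observations \<pi> y \<omega> t) \<omega>) \<in> measurable M (count_space ?J)"
  proof (rule measurable_compose_countable'[OF _ I(2) I(1)])
    fix h assume "h \<in> I"
    moreover have "\<pi> h \<in> measurable M (count_space A)"
      using alg by (simp add: bandit_algorithm_def)
    ultimately show "(\<lambda>\<omega>. h @ [y (Suc t) (\<pi> h \<omega>)]) \<in> measurable M (count_space ?J)"
      by (intro measurable_compose[of "\<pi> h" M "count_space A" "\<lambda>a. h @ [y (Suc t) a]"]) auto
  qed
  moreover have "countable ?J" using I(1) A by (auto intro: countable_finite)
  ultimately show ?case by (intro exI[of _ ?J]) simp
qed

lemma played_measurable:
  assumes alg: "bandit_algorithm A M \<pi>" and A: "finite A"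
  shows "played \<pi> y t \<in> measurable M (count_space A)"
proof -
  obtain I where I: "countable I" "(\<lambda>\<omega>. observations \<pi> y \<omega> (t - 1)) \<in> measurable M (count_space I)"
    using observations_measurable[OF assms] by blast
  have "(\<lambda>\<omega>. \<pi> (observations \<pi> y \<omega> (t - 1)) \<omega>) \<in> measurable M (count_space A)"
    by (rule measurable_compose_countable'[OF _ I(2) I(1)]) (use alg in \<open>simp add: bandit_algorithm_def\<close>)
  then show ?thesis by (simp add: played_def[abs_def])
qed

lemma played_mem:
  assumes "bandit_algorithm A M \<pi>" "finite A" "\<omega> \<in> space M"
  shows "played \<pi> y t \<omega> \<in> A"
  using measurable_space[OF played_measurable[OF assms(1,2)] assms(3)] by simp

lemma regret_integrable:
  assumes alg: "bandit_algorithm A M \<pi>" and A: "finite A"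
  shows "integrable M (regret A T \<pi> y)"
proof -
  interpret prob_space M using alg by (simp add: bandit_algorithm_def)
  have "integrable M (\<lambda>\<omega>. y t (played \<pi> y t \<omega>))" for t
  proof (rule integrable_const_bound)
    show "AE \<omega> in M. norm (y t (played \<pi> y t \<omega>)) \<le> (\<Sum>a\<in>A. \<bar>y t a\<bar>)"
      using played_mem[OF alg A] A by (auto intro!: AE_I2 member_le_sum[where f = "\<lambda>a. \<bar>y t a\<bar>"])
    show "(\<lambda>\<omega>. y t (played \<pi> y t \<omega>)) \<in> borel_measurable M"
      by (rule measurable_compose[OF played_measurable[OF alg A]]) simp
  qed
  then show ?thesis unfolding regret_def[abs_def] by simp
qed

text \<open>Makes the real-valued supremum in the theorem an actual upper bound.\<close>

lemma expected_regret_le: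
  assumes alg: "bandit_algorithm (leaves G) M \<pi>" and A: "finite (leaves G)" "leaves G \<noteq> {}"
    and y: "y \<in> loss_sequences G L \<sigma> T"
  shows "expected_regret (leaves G) T M \<pi> y \<le> real T"
proof -
  interpret prob_space M using alg by (simp add: bandit_algorithm_def)
  have y01: "0 \<le> y t a" "y t a \<le> 1" if "t \<in> {1..T}" "a \<in> leaves G" for t a
    using y that by (auto simp: loss_sequences_def)
  have "regret (leaves G) T \<pi> y \<omega> \<le> real T" if "\<omega> \<in> space M" for \<omega>
  proof -
    have "(\<Sum>t = 1..T. y t (played \<pi> y t \<omega>)) \<le> (\<Sum>t = 1..T. 1)"
      using y01 played_mem[OF alg A(1) that] by (intro sum_mono) auto
    moreover have "0 \<le> (MIN a \<in> leaves G. \<Sum>t = 1..T. y t a)"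
      using A y01 by (subst Min_ge_iff) (auto intro!: sum_nonneg)
    ultimately show ?thesis by (simp add: regret_def)
  qed
  then show ?thesis
    unfolding expected_regret_def
    by (intro integral_le_const regret_integrable[OF alg A(1)]) auto
qed

text \<open>Rounds start at \<open>1\<close> and list positions at \<open>0\<close>, hence the index
  \<open>t - 1\<close>.\<close>

lemma observations_history:
  assumes "t \<le> length zs"
  shows "observations \<pi> (\<lambda>t. l (zs ! (t - 1))) \<omega> t = history (\<lambda>h. \<pi> h \<omega>) l (take t zs)"
  using assms
proof (induction t)
  case (Suc t)
  then have "take (Suc t) zs = take t zs @ [zs ! t]"
    by (simp add: take_Suc_conv_app_nth)
  moreover have "observations \<pi> (\<lambda>t. l (zs ! (t - 1))) \<omega> t = history (\<lambda>h. \<pi> h \<omega>) l (take t zs)"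
    using Suc by simp
  ultimately show ?case
    by (simp only: observations.simps history_snoc diff_Suc_1)
qed simp

lemma pseudo_regret_le_regret:
  assumes "finite A" "i \<in> A" "length zs = T"
  shows "pseudo_regret (\<lambda>h. \<pi> h \<omega>) l i zs \<le> regret A T \<pi> (\<lambda>t. l (zs ! (t - 1))) \<omega>"
proof -
  have "(MIN a \<in> A. \<Sum>t = 1..T. l (zs ! (t - 1)) a) \<le> (\<Sum>t = 1..T. l (zs ! (t - 1)) i)"
    using assms by (intro Min_le) auto
  then have "(\<Sum>t = 1..T. l (zs ! (t - 1)) (played \<pi> (\<lambda>t. l (zs ! (t - 1))) t \<omega>) - l (zs ! (t - 1)) i)
      \<le> regret A T \<pi> (\<lambda>t. l (zs ! (t - 1))) \<omega>"
    by (simp add: regret_def sum_subtractf)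
  moreover have "(\<Sum>t = 1..T. l (zs ! (t - 1)) (played \<pi> (\<lambda>t. l (zs ! (t - 1))) t \<omega>) - l (zs ! (t - 1)) i)
      = pseudo_regret (\<lambda>h. \<pi> h \<omega>) l i zs"
  proof -
    have "observations \<pi> (\<lambda>t. l (zs ! (t - 1))) \<omega> s = history (\<lambda>h. \<pi> h \<omega>) l (take s zs)"
      if "s < T" for s
      using observations_history[of s zs \<pi> l \<omega>] that assms(3) by simp
    then show ?thesis
      unfolding pseudo_regret_def One_nat_def sum.atLeast1_atMost_eq assms(3) played_def by simp
  qed
  ultimately show ?thesis by simp
qed

text \<open>The summed bound holds for every seed, hence after integration. Some arm reaches the
  average over \<open>A\<close>, and then some noise sequence the average over noise.\<close>

lemma exists_large_regret:
  assumes alg: "bandit_algorithm A M \<pi>" and A: "finite A" and m: "m > 1"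
    and B: "real T * (2 / 3 * real (card A) - 1 - real T / ((real m)\<^sup>2 - 1)) / (4 * real m) > real (card A) * B"
  shows "\<exists>i\<in>A. \<exists>zs. length zs = T \<and> set zs \<subseteq> noise m \<and>
    expected_regret A T M \<pi> (\<lambda>t. arm_loss m i (zs ! (t - 1))) > B"
proof -
  interpret prob_space M using alg by (simp add: bandit_algorithm_def)
  have m0: "m > 0" using m by simp
  define y where "y i zs t = arm_loss m i (zs ! (t - 1))" for i :: 'a and zs and t :: nat
  let ?R = "\<lambda>i zs \<omega>. regret A T \<pi> (y i zs) \<omega>"
  define V where "V = real T * (2 / 3 * real (card A) - 1 - real T / ((real m)\<^sup>2 - 1)) / (4 * real m)"
  have int: "integrable M (\<lambda>\<omega>. seq_mean (noise m) T (\<lambda>zs. ?R i zs \<omega>))" for i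
    by (rule seq_mean_integrable) (rule regret_integrable[OF alg A])
  have "V \<le> (\<Sum>i\<in>A. seq_mean (noise m) T (\<lambda>zs. ?R i zs \<omega>))" if "\<omega> \<in> space M" for \<omega>
  proof -
    have "\<pi> h \<omega> \<in> A" for h
      using measurable_space[of "\<pi> h" M "count_space A", OF _ that] alg
      by (simp add: bandit_algorithm_def)
    then have "V \<le> (\<Sum>i\<in>A. seq_mean (noise m) T (pseudo_regret (\<lambda>h. \<pi> h \<omega>) (arm_loss m i) i))"
      unfolding V_def by (intro sum_mean_pseudo_regret[OF A _ m])
    also have "\<dots> \<le> (\<Sum>i\<in>A. seq_mean (noise m) T (\<lambda>zs. ?R i zs \<omega>))"
      unfolding y_def by (intro sum_mono seq_mean_mono) (rule pseudo_regret_le_regret[OF A])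
    finally show ?thesis .
  qed
  then have "V \<le> (\<integral>\<omega>. (\<Sum>i\<in>A. seq_mean (noise m) T (\<lambda>zs. ?R i zs \<omega>)) \<partial>M)"
    using int by (intro integral_ge_const Bochner_Integration.integrable_sum AE_I2)
  also have "\<dots> = (\<Sum>i\<in>A. seq_mean (noise m) T (\<lambda>zs. expected_regret A T M \<pi> (y i zs)))"
    unfolding expected_regret_def
    by (simp only: Bochner_Integration.integral_sum[OF int] seq_mean_integral[OF regret_integrable[OF alg A]])
  finally have "(\<Sum>i\<in>A. B) < (\<Sum>i\<in>A. seq_mean (noise m) T (\<lambda>zs. expected_regret A T M \<pi> (y i zs)))"
    using B by (simp add: V_def)
  then obtain i where "i \<in> A" "seq_mean (noise m) T (\<lambda>zs. expected_regret A T M \<pi> (y i zs)) > B"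
    by (meson not_le sum_mono)
  then obtain zs where "length zs = T" "set zs \<subseteq> noise m" "expected_regret A T M \<pi> (y i zs) > B"
    using seq_mean_exists[OF finite_noise noise_nonempty[OF m0]] by meson
  with \<open>i \<in> A\<close> show ?thesis
    unfolding y_def by (intro bexI[of _ i] exI[of _ zs] conjI)
qed

section \<open>Choice of the mesh and conclusion\<close>

lemma arm_loss_sequence:
  assumes tree: "tree_of_depth G L"
    and dec: "\<And>i j. 1 \<le> i \<Longrightarrow> i \<le> j \<Longrightarrow> j \<le> L \<Longrightarrow> \<sigma> j \<le> \<sigma> i"
    and last: "\<sigma> (L + 1) = 0" and step: "1 / (2 * real m) \<le> \<sigma> L"
    and zs: "length zs = T" "set zs \<subseteq> noise m"
  shows "(\<lambda>t. arm_loss m i (zs ! (t - 1))) \<in> loss_sequences G L \<sigma> T"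
proof -
  have "zs ! (t - 1) \<in> noise m" if "t \<in> {1..T}" for t
    using that zs by (intro subsetD[OF zs(2)] nth_mem) auto
  moreover have "\<bar>arm_loss m i z a - arm_loss m i z b\<bar> \<le> \<sigma> (similarity G L a b)"
    if "a \<in> leaves G" "b \<in> leaves G" for z a b
  proof (cases "a = b")
    case True
    then show ?thesis using similarity_self[OF tree that(1)] last by simp
  next
    case False
    then show ?thesis
      using arm_loss_diff[of m i z a b] step dec[of "similarity G L a b" L]
        similarity_distinct[OF tree that False] by linarith
  qed
  ultimately show ?thesis
    unfolding loss_sequences_def mem_Collect_eq
    by (intro ballI conjI arm_loss_range)
qed

theorem proposition1:
  fixes G :: "'v rtree" and L K T :: nat and \<sigma> :: "nat \<Rightarrow> real" and \<rho> :: real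
    and M :: "'w measure" and \<pi> :: "real list \<Rightarrow> 'w \<Rightarrow> 'v"
  assumes tree: "tree_of_depth G L"
    and card_leaves: "card (leaves G) = K"
    and scales_decreasing: "\<And>i j. 1 \<le> i \<Longrightarrow> i \<le> j \<Longrightarrow> j \<le> L \<Longrightarrow> \<sigma> j \<le> \<sigma> i"
    and scale_last: "\<sigma> (L + 1) = 0"
    and rho: "\<rho> = \<sigma> L"
    and K: "K > 2"
    and T: "real T > 32 * (real K - 1) * ln 14"
    and rho_large: "\<rho> > 0.22 * sqrt ((real K - 1) / real T)"
    and algorithm: "bandit_algorithm (leaves G) M \<pi>"
  shows "(SUP y \<in> loss_sequences G L \<sigma> T. expected_regret (leaves G) T M \<pi> y)
           > 1 / 504 * sqrt (real T * (real K - 1))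
       \<and> (\<exists>y \<in> loss_sequences G L \<sigma> T.
            expected_regret (leaves G) T M \<pi> y > 1 / 504 * sqrt (real T * (real K - 1)))"
proof -
  define A where "A = leaves G"
  define n where "n = real K - 1"
  define q where "q = sqrt (real T / n)"
  \<comment> \<open>Since \<open>25 / 11 = 1 / (2 * 0.22)\<close>, this is the coarsest grid with
    mesh at most \<open>0.22 / q\<close>.\<close>
  define m where "m = nat \<lceil>25 / 11 * q\<rceil>"
  have n: "n \<ge> 2" using K by (simp add: n_def)
  have A: "finite A" "A \<noteq> {}" "card A = K"
    using card_leaves K by (auto simp: A_def intro: card_ge_0_finite)
  \<comment> \<open>Bounding \<open>ln 14\<close> below by \<open>1\<close> turns the condition on
    \<open>T\<close> into \<open>q\<^sup>2 > 32\<close>.\<close>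
  have "exp 1 \<le> (14 :: real)" using exp_le by simp
  then have "ln 14 \<ge> (1 :: real)" by (simp add: ln_ge_iff)
  then have "32 * n * 1 \<le> 32 * n * ln 14" using n by (intro mult_left_mono) auto
  then have T32: "real T > 32 * n" using T by (simp add: n_def)
  then have q2: "q\<^sup>2 = real T / n" and q2_ge: "q\<^sup>2 > 32"
    using n by (auto simp: q_def field_simps)
  have q: "q > 5"
    using q2_ge n by (intro power2_less_imp_less[of 5 q]) (auto simp: q_def)
  \<comment> \<open>Rounding up costs at most \<open>1\<close>, and
    \<open>5 / 2 - 25 / 11 = 5 / 22\<close> exceeds \<open>1 / q\<close>.\<close>
  have m_lower: "25 / 11 * q \<le> real m" and m_upper: "real m \<le> 5 / 2 * q"
    using q unfolding m_def by linarith+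
  have m: "m > 1" using m_lower q by linarith
  have "0.22 * sqrt ((real K - 1) / real T) = 0.22 / q"
    using n T32 by (simp add: q_def n_def real_sqrt_divide)
  also have "\<dots> \<ge> 1 / (2 * real m)"
    using m_lower m q by (simp add: field_simps)
  finally have step: "1 / (2 * real m) \<le> \<sigma> L" using rho_large rho by linarith
  have sqrt_eq: "sqrt (real T * (real K - 1)) = real T / q"
    using n T32 by (simp add: q_def n_def[symmetric] real_sqrt_divide real_sqrt_mult real_div_sqrt field_simps)
  have "(25 / 11 * q)\<^sup>2 \<le> (real m)\<^sup>2"
    using m_lower q by (intro power_mono) auto
  \<comment> \<open>The square of \<open>25 / 11\<close> is \<open>5 + 20 / 121\<close>, and
    \<open>20 / 121 * q\<^sup>2\<close> absorbs the \<open>1\<close>.\<close>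
  then have "(real m)\<^sup>2 - 1 \<ge> 5 * q\<^sup>2"
    using q2_ge by (simp add: power_mult_distrib power_divide)
  moreover from this have "(real m)\<^sup>2 - 1 > 0" using q2_ge by linarith
  ultimately have "real T / ((real m)\<^sup>2 - 1) \<le> real T / (5 * q\<^sup>2)"
    using q by (intro divide_left_mono mult_pos_pos) auto
  also have "\<dots> = n / 5" using n T32 by (simp add: q2 field_simps)
  \<comment> \<open>The inequality \<open>2 / 3 * K - 1 - (K - 1) / 5 \<ge> K / 5\<close> amounts to
    \<open>K \<ge> 3\<close>.\<close>
  finally have "2 / 3 * real K - 1 - real T / ((real m)\<^sup>2 - 1) \<ge> real K / 5"
    using K by (simp add: n_def)
  then have "real T * (2 / 3 * real K - 1 - real T / ((real m)\<^sup>2 - 1)) / (4 * real m) \<ge> real T * (real K / 5) / (4 * real m)"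
    by (intro divide_right_mono mult_left_mono) auto
  moreover have "real T * (real K / 5) / (4 * real m) \<ge> real T * (real K / 5) / (4 * (5 / 2 * q))"
    using m_upper m q by (intro divide_left_mono mult_pos_pos) auto
  \<comment> \<open>Per arm this is \<open>T / (50 * q)\<close>, against the required
    \<open>T / (504 * q)\<close>.\<close>
  moreover have "real T * (real K / 5) / (4 * (5 / 2 * q)) > real K * (1 / 504 * sqrt (real T * (real K - 1)))"
    unfolding sqrt_eq using q K T32 n by (simp add: field_simps)
  ultimately have "real T * (2 / 3 * real (card A) - 1 - real T / ((real m)\<^sup>2 - 1)) / (4 * real m)
      > real (card A) * (1 / 504 * sqrt (real T * (real K - 1)))"
    unfolding A(3) by linarith
  then obtain i zs where zs: "length zs = T" "set zs \<subseteq> noise m"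
    and big: "expected_regret A T M \<pi> (\<lambda>t. arm_loss m i (zs ! (t - 1))) > 1 / 504 * sqrt (real T * (real K - 1))"
    using exists_large_regret[OF algorithm[folded A_def] A(1) m] by blast
  let ?y = "\<lambda>t. arm_loss m i (zs ! (t - 1))"
  have y: "?y \<in> loss_sequences G L \<sigma> T"
    by (rule arm_loss_sequence[OF tree scales_decreasing scale_last step zs])
  have "bdd_above (expected_regret (leaves G) T M \<pi> ` loss_sequences G L \<sigma> T)"
    using expected_regret_le[OF algorithm] A by (intro bdd_aboveI2[of _ _ "real T"]) (auto simp: A_def)
  then have "expected_regret (leaves G) T M \<pi> ?y
      \<le> (SUP y \<in> loss_sequences G L \<sigma> T. expected_regret (leaves G) T M \<pi> y)"
    using y by (intro cSUP_upper)
  with big y show ?thesis unfolding A_def by fastforce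
qed

end
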